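(* Let $\{a_n\}_{n\in\mathbb{N}}$ be a sequence of complex numbers such that, for some $\delta\in[0,\pi/2)$, $$\sum_{m=1}^\infty |a_m|\,e^{-\delta m}<\infty .$$ Then for every $n\in\mathbb{N}$ both expansions $$a_n=\frac{2}{\pi^2}\, n\sinh(\pi n)\int_0^\infty K_c(x,in,\pi)\sum_{m=1}^\infty a_m K_{im}(x)\,\frac{dx}{x},$$ $$a_n=\frac{2}{\pi^2}\, n\sinh(\pi n)\int_0^\infty K_{in}(x)\sum_{m=1}^\infty a_m K_c(x,im,\pi)\,\frac{dx}{x}$$ hold, where the iterated series and integral converge absolutely. Moreover, the second expansion holds for the wider class of sequences satisfying $$\sum_{m=1}^\infty \frac{|a_m|}{m}\,e^{-\pi m/2}<\infty .$$
   Context: $\mathbb{N}=\{1,2,\dots\}$ and $i$ is the imaginary unit. $K_\nu$ is the modified Bessel (Macdonald) function, $K_\nu(x)=\int_0^\infty e^{-x\cosh u}\cosh(\nu u)\,du$ for $x>0$, $\nu\in\mathbb{C}$; thus $K_{in}(x)=\int_0^\infty e^{-x\cosh u}\cos(nu)\,du$. The function $K_c$ is defined by $K_c(x,\nu,w)=\frac{1}{\cos(\pi\nu/2)}\int_0^w\cos(x\sinh u)\cosh(\nu u)\,du$; thus $K_c(x,in,\pi)=\frac{1}{\cosh(\pi n/2)}\int_0^\pi\cos(x\sinh u)\cos(nu)\,du$. *)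

theory Defs
  imports "HOL-Analysis.Analysis"
begin

definition macdonald_K :: "complex \<Rightarrow> real \<Rightarrow> complex" where
  "macdonald_K \<nu> x =
     (LBINT u:{0..}. complex_of_real (exp (- x * cosh u)) * cosh (\<nu> * complex_of_real u))"

definition K_c :: "real \<Rightarrow> complex \<Rightarrow> real \<Rightarrow> complex" where
  "K_c x \<nu> w =
     1 / cos (complex_of_real pi * \<nu> / 2) *
     (LBINT u=0..w. complex_of_real (cos (x * sinh u)) * cosh (\<nu> * complex_of_real u))"

text \<open>Series over the positive integers are written with the index shifted: the summand of index
  \<open>m \<ge> 1\<close> is the term \<open>f (Suc k)\<close> with \<open>m = Suc k\<close>, so \<open>f 0\<close> is never used.\<close>

definition iterated_integral :: "(real \<Rightarrow> complex) \<Rightarrow> (nat \<Rightarrow> real \<Rightarrow> complex) \<Rightarrow> complex" where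
  "iterated_integral g f =
     (LBINT x:{0<..}. g x * (\<Sum>k. f (Suc k) x) / complex_of_real x)"

text \<open>Absolute convergence of the series at every point, of the integral of its sum, and of the
  iterated expression with every term replaced by its modulus. The third condition implies the
  second for measurable data, but not conversely.\<close>

definition iterated_abs_convergent :: "(real \<Rightarrow> complex) \<Rightarrow> (nat \<Rightarrow> real \<Rightarrow> complex) \<Rightarrow> bool" where
  "iterated_abs_convergent g f \<longleftrightarrow>
     (\<forall>x>0. summable (\<lambda>k. norm (f (Suc k) x))) \<and>
     set_integrable lborel {0<..} (\<lambda>x. g x * (\<Sum>k. f (Suc k) x) / complex_of_real x) \<and>
     set_integrable lborel {0<..} (\<lambda>x. norm (g x) * (\<Sum>k. norm (f (Suc k) x)) / x)"

end

theory Submission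
  imports Defs "HOL-Complex_Analysis.Complex_Analysis"
begin

text \<open>
  Write \<open>K\<^sub>m\<close> for the Macdonald function of order \<open>\<i>m\<close> and \<open>C\<^sub>n\<close> for the truncated kernel of order \<open>\<i>n\<close>
  with cut-off \<open>\<pi>\<close>; both are real. The two families are biorthogonal with respect to \<open>dx/x\<close> on
  \<open>(0, \<infinity>)\<close>: the integral of \<open>C\<^sub>n K\<^sub>m\<close> is \<open>\<pi>\<^sup>2 / (2 n sinh (\<pi>n))\<close> if \<open>n = m\<close> and \<open>0\<close> otherwise
  (\<open>trunc_K_bessel_K_biorthogonal\<close>). Both expansions follow by integrating the series term by term.

  For the biorthogonality, integration by parts (the boundary terms vanish at \<open>0\<close> and \<open>\<pi>\<close>) writes
  \<open>C\<^sub>n(x)\<close> as \<open>x / (n cosh (\<pi>n/2))\<close> times the integral of \<open>cosh u sin (x sinh u) sin (n u)\<close> over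
  \<open>[0, \<pi>]\<close>. Exchanging integrals leaves the sine transform of \<open>K\<^sub>m\<close> at \<open>sinh u\<close>. By Fubini and the
  residue theorem in a strip of height \<open>\<pi>\<close>, its value is
  \<open>(\<pi>/2) sin (m u) / (sinh (\<pi>m/2) cosh u)\<close> (\<open>bessel_K_sine_transform\<close>). The factor \<open>cosh u\<close>
  cancels, and the orthogonality of \<open>sin (n u)\<close> and \<open>sin (m u)\<close> on \<open>[0, \<pi>]\<close> remains.

  Termwise integration rests on two bounds. The formula by parts gives
  \<open>\<bar>C\<^sub>m(x)\<bar> \<le> 2 sinh \<pi> exp (-\<pi>m/2) x / m\<close> (\<open>abs_trunc_K_le\<close>), and moving the line of integration gives
  \<open>\<bar>K\<^sub>m(x)\<bar> \<le> exp (-\<delta>m) K\<^sub>0(x cos \<delta>)\<close> for \<open>0 \<le> \<delta> < \<pi>/2\<close> (\<open>abs_bessel_K_le_exp\<close>). In each expansion the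
  factor \<open>x\<close> coming from \<open>C\<close> cancels \<open>1/x\<close>, and \<open>K\<^sub>0\<close> is integrable on \<open>(0, \<infinity>)\<close>.
\<close>

section \<open>Line integrals along the edges of a strip\<close>

lemma integral_symmetric_truncation_tendsto:
  fixes f :: "real \<Rightarrow> complex"
  assumes f: "integrable lborel f"
  shows "((\<lambda>R. LBINT t:{-R..R}. f t) \<longlongrightarrow> (\<integral>t. f t \<partial>lborel)) at_top"
  unfolding set_lebesgue_integral_def
proof (rule integral_dominated_convergence_at_top[where w = "\<lambda>t. norm (f t)"])
  show "AE x in lborel. ((\<lambda>R. indicator {- R..R} x *\<^sub>R f x) \<longlongrightarrow> f x) at_top"
  proof (intro AE_I2 tendsto_eventually)
    fix x :: real
    show "\<forall>\<^sub>F R in at_top. indicator {- R..R} x *\<^sub>R f x = f x"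
      using eventually_ge_at_top[of "\<bar>x\<bar>"] by eventually_elim (auto simp: indicator_def)
  qed
  show "\<forall>\<^sub>F R in at_top. AE x in lborel. norm (indicator {- R..R} x *\<^sub>R f x) \<le> norm (f x)"
    by (intro always_eventually allI AE_I2) (auto simp: indicator_def)
qed (use f in auto)

lemma contour_integral_linepath_translate:
  "contour_integral (linepath (a + c) (b + c)) f = contour_integral (linepath a b) (\<lambda>z. f (z + c))"
proof -
  have "linepath (a + c) (b + c) x = linepath a b x + c" for x
    by (simp add: linepath_def algebra_simps)
  hence "(f has_contour_integral i) (linepath (a + c) (b + c)) \<longleftrightarrow>
        ((\<lambda>z. f (z + c)) has_contour_integral i) (linepath a b)" for i
    by (simp add: has_contour_integral_linepath)
  thus ?thesis unfolding contour_integral_def contour_integrable_on_def by simp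
qed

lemma contour_integral_horizontal_linepath:
  fixes f :: "complex \<Rightarrow> complex"
  assumes "integrable lborel (\<lambda>t. f (of_real t + c))" "R > 0"
  shows "contour_integral (linepath (of_real (-R) + c) (of_real R + c)) f =
           (LBINT t:{-R..R}. f (of_real t + c))"
proof -
  have "set_integrable lborel {-R..R} (\<lambda>t. f (of_real t + c))"
    using assms by (simp add: set_integrable_def integrable_mult_indicator)
  hence "(LBINT t:{-R..R}. f (of_real t + c)) = integral {-R..R} (\<lambda>t. f (of_real t + c))"
    by (rule set_borel_integral_eq_integral)
  thus ?thesis
    using assms(2) by (simp only: contour_integral_linepath_translate)
       (subst contour_integral_linepath_Reals_eq, auto)
qed

text \<open>The difference of the integrals over the two edges of a horizontal strip is given by the
  residues inside, provided that \<open>f\<close> decays at both ends of the strip. With no poles this says that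
  the line of integration may be moved.\<close>

lemma strip_residue_theorem:
  fixes f :: "complex \<Rightarrow> complex" and h \<epsilon> :: real and B :: "real \<Rightarrow> real"
  assumes h: "h \<ge> 0" and \<epsilon>: "\<epsilon> > 0"
    and P: "finite P" "\<And>p. p \<in> P \<Longrightarrow> 0 < Im p \<and> Im p < h"
    and holo: "f holomorphic_on ({z. -\<epsilon> < Im z \<and> Im z < h + \<epsilon>} - P)"
    and int0: "integrable lborel (\<lambda>t. f (of_real t))"
    and inth: "integrable lborel (\<lambda>t. f (of_real t + \<i> * of_real h))"
    and bound: "\<And>R s. R \<ge> R0 \<Longrightarrow> 0 \<le> s \<Longrightarrow> s \<le> h \<Longrightarrow>
                  norm (f (Complex R s)) \<le> B R \<and> norm (f (Complex (-R) s)) \<le> B R"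
    and B: "(B \<longlongrightarrow> 0) at_top"
  shows "(\<integral>t. f (of_real t) \<partial>lborel) - (\<integral>t. f (of_real t + \<i> * of_real h) \<partial>lborel) =
           2 * pi * \<i> * (\<Sum>p\<in>P. residue f p)"
proof -
  define S where "S = {z::complex. -\<epsilon> < Im z \<and> Im z < h + \<epsilon>}"
  define I where "I = 2 * pi * \<i> * (\<Sum>p\<in>P. residue f p)"
  define T where "T R = (LBINT t:{-R..R}. f (of_real t)) - (LBINT t:{-R..R}. f (of_real t + \<i> * of_real h))" for R
  have S_eq: "S = {z. Im z > -\<epsilon>} \<inter> {z. Im z < h + \<epsilon>}" by (auto simp: S_def)
  have openS: "open S" unfolding S_eq by (intro open_Int open_halfspace_Im_gt open_halfspace_Im_lt)
  have convS: "convex S" unfolding S_eq by (intro convex_Int convex_halfspace_Im_gt convex_halfspace_Im_lt)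
  have cont: "continuous_on (S - P) f" using holo holomorphic_on_imp_continuous_on S_def by blast
  obtain R1 where R1: "R1 > 0" "\<And>p. p \<in> P \<Longrightarrow> \<bar>Re p\<bar> < R1"
  proof -
    have "finite ((\<lambda>p. \<bar>Re p\<bar>) ` P)" using P by simp
    then obtain M where M: "\<forall>y\<in>(\<lambda>p. \<bar>Re p\<bar>) ` P. y \<le> M"
      by (meson bdd_above.E bdd_above_finite)
    show ?thesis by (rule that[of "max M 0 + 1"]) (use M in force)+
  qed
  have key: "norm (T R - I) \<le> 2 * h * B R" if R: "R \<ge> max R0 R1" for R
  proof -
    have Rpos: "R > 0" and RP: "\<And>p. p \<in> P \<Longrightarrow> \<bar>Re p\<bar> < R" using R R1 by force+
    define a b c d where "a = of_real (-R) + (0::complex)" and "b = of_real R + (0::complex)"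
      and "c = of_real R + \<i> * of_real h" and "d = of_real (-R) + \<i> * of_real h"
    note abcd = a_def b_def c_def d_def
    have Bpos: "B R \<ge> 0" using bound[of R 0] h R by (meson max.boundedE norm_ge_zero order_refl order_trans)
    have rp: "rectpath a c = linepath a b +++ linepath b c +++ linepath c d +++ linepath d a"
    proof -
      have "Complex (Re c) (Im a) = b" "Complex (Re a) (Im c) = d" by (simp_all add: abcd complex_eq_iff)
      thus ?thesis by (simp add: rectpath_def Let_def)
    qed
    have le: "Re a \<le> Re c" "Im a \<le> Im c" using Rpos h by (auto simp: abcd)
    have rpim: "path_image (rectpath a c) = {z. Re z \<in> {Re a, Re c} \<and> Im z \<in> {Im a..Im c}} \<union>
        {z. Im z \<in> {Im a, Im c} \<and> Re z \<in> {Re a..Re c}}"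
      by (rule path_image_rectpath[OF le])
    have img: "path_image (rectpath a c) \<subseteq> S - P"
    proof
      fix z assume z: "z \<in> path_image (rectpath a c)"
      have "z \<in> S" using z \<epsilon> h unfolding rpim by (auto simp: S_def abcd)
      moreover have "z \<notin> P"
      proof
        assume "z \<in> P"
        from RP[OF this] P(2)[OF this] show False using z unfolding rpim by (auto simp: abcd)
      qed
      ultimately show "z \<in> S - P" by blast
    qed
    have sides: "closed_segment b c \<subseteq> path_image (rectpath a c)" "closed_segment d a \<subseteq> path_image (rectpath a c)"
         "closed_segment a b \<subseteq> path_image (rectpath a c)" "closed_segment c d \<subseteq> path_image (rectpath a c)"
      unfolding rp by (auto simp: path_image_join)
    have wind: "winding_number (rectpath a c) p = 1" if "p \<in> P" for p
      using that RP[OF that] P(2)[OF that] by (intro winding_number_rectpath) (auto simp: in_box_complex_iff abcd)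
    have "contour_integral (rectpath a c) f = 2 * pi * \<i> * (\<Sum>p\<in>P. winding_number (rectpath a c) p * residue f p)"
    proof (rule Residue_theorem[OF openS _ P(1)])
      show "connected S" using convS by (rule convex_connected)
      show "f holomorphic_on S - P" using holo by (simp add: S_def)
      show "\<forall>z. z \<notin> S \<longrightarrow> winding_number (rectpath a c) z = 0"
        using le \<epsilon> by (intro allI impI winding_number_rectpath_outside)
          (auto simp: S_def in_cbox_complex_iff abcd)
    qed (use img in auto)
    also have "\<dots> = I" using wind by (simp add: I_def)
    finally have 1: "contour_integral (rectpath a c) f = I" .
    have ci: "f contour_integrable_on linepath x y" if "closed_segment x y \<subseteq> path_image (rectpath a c)" for x y
      using that img by (intro contour_integrable_continuous_linepath continuous_on_subset[OF cont]) auto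
    have "contour_integral (rectpath a c) f = contour_integral (linepath a b) f + (contour_integral (linepath b c) f
            + (contour_integral (linepath c d) f + contour_integral (linepath d a) f))"
      unfolding rp using ci[OF sides(1)] ci[OF sides(2)] ci[OF sides(3)] ci[OF sides(4)]
      by (simp add: contour_integral_join valid_path_join contour_integrable_joinI)
    moreover have "contour_integral (linepath a b) f = (LBINT t:{-R..R}. f (of_real t))"
      unfolding abcd using contour_integral_horizontal_linepath[of f 0 R] int0 Rpos by simp
    moreover have "contour_integral (linepath c d) f = - (LBINT t:{-R..R}. f (of_real t + \<i> * of_real h))"
      unfolding abcd using contour_integral_horizontal_linepath[of f "\<i> * of_real h" R] inth Rpos
        contour_integral_reverse_linepath[of d c f] ci[OF sides(4)] continuous_on_subset[OF cont]
        img sides(4) by (simp add: abcd closed_segment_commute)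
    moreover have "norm (contour_integral (linepath b c) f) \<le> B R * norm (c - b)"
    proof (rule contour_integral_bound_linepath[OF ci[OF sides(1)] Bpos])
      fix z assume "z \<in> closed_segment b c"
      hence "z = Complex R (Im z)" "0 \<le> Im z" "Im z \<le> h"
        using h by (auto simp: abcd closed_segment_same_Re closed_segment_eq_real_ivl complex_eq_iff split: if_splits)
      thus "norm (f z) \<le> B R" using bound[of R "Im z"] R by auto
    qed
    moreover have "norm (contour_integral (linepath d a) f) \<le> B R * norm (a - d)"
    proof (rule contour_integral_bound_linepath[OF ci[OF sides(2)] Bpos])
      fix z assume "z \<in> closed_segment d a"
      hence "z = Complex (-R) (Im z)" "0 \<le> Im z" "Im z \<le> h"
        using h by (auto simp: abcd closed_segment_same_Re closed_segment_eq_real_ivl complex_eq_iff split: if_splits)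
      thus "norm (f z) \<le> B R" using bound[of R "Im z"] R by auto
    qed
    moreover have "norm (c - b) = h" "norm (a - d) = h" using h by (auto simp: abcd norm_mult)
    ultimately have "norm (contour_integral (linepath b c) f) \<le> h * B R"
       "norm (contour_integral (linepath d a) f) \<le> h * B R"
       "T R - I = - (contour_integral (linepath b c) f + contour_integral (linepath d a) f)"
      using 1 by (auto simp: T_def algebra_simps)
    thus ?thesis using norm_triangle_ineq[of "contour_integral (linepath b c) f" "contour_integral (linepath d a) f"]
      by (simp only: norm_minus_cancel)
  qed
  have "((\<lambda>R. T R - I) \<longlongrightarrow> 0) at_top"
  proof (rule tendsto_norm_zero_cancel, rule tendsto_sandwich)
    show "\<forall>\<^sub>F R in at_top. 0 \<le> norm (T R - I)" by simp
    show "\<forall>\<^sub>F R in at_top. norm (T R - I) \<le> 2 * h * B R"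
      using eventually_ge_at_top[of "max R0 R1"] by eventually_elim (rule key)
    show "((\<lambda>R. 2 * h * B R) \<longlongrightarrow> 0) at_top" using tendsto_mult_right_zero[OF B] by simp
  qed simp
  moreover have "((\<lambda>R. T R - I) \<longlongrightarrow> ((\<integral>t. f (of_real t) \<partial>lborel) - (\<integral>t. f (of_real t + \<i> * of_real h) \<partial>lborel)) - I) at_top"
    unfolding T_def
    by (intro tendsto_intros integral_symmetric_truncation_tendsto int0 inth)
  ultimately show ?thesis
    using tendsto_unique[OF trivial_limit_at_top_linorder] unfolding I_def by fastforce
qed

section \<open>The two kernels as real functions\<close>

text \<open>For real \<open>\<nu>\<close>, this is the Macdonald function \<open>K\<close> of the imaginary order \<open>\<i>\<nu>\<close>, as a real-valued
  function. It is meaningful for \<open>x > 0\<close> only; elsewhere the integrand need not be integrable and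
  the value is irrelevant.\<close>

definition bessel_K :: "real \<Rightarrow> real \<Rightarrow> real" where
  "bessel_K \<nu> x = (LBINT u:{0..}. exp (- (x * cosh u)) * cos (\<nu> * u))"

text \<open>The truncated kernel at order \<open>\<i>\<nu>\<close> and cut-off \<open>\<pi>\<close>, again as a real-valued function. The factor
  \<open>1 / cosh (\<pi>\<nu>/2)\<close> is \<open>1 / cos (\<pi>\<mu>/2)\<close> at \<open>\<mu> = \<i>\<nu>\<close>.\<close>

definition trunc_K :: "real \<Rightarrow> real \<Rightarrow> real" where
  "trunc_K \<nu> x = (LBINT u:{0..pi}. cos (x * sinh u) * cos (\<nu> * u)) / cosh (pi * \<nu> / 2)"

lemma borel_measurable_cosh_sinh [measurable]:
  "(cosh :: real \<Rightarrow> real) \<in> borel_measurable borel"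
  "(sinh :: real \<Rightarrow> real) \<in> borel_measurable borel"
  by (intro borel_measurable_continuous_onI continuous_intros)+

lemma cosh_complex_of_real: "cosh (complex_of_real y) = of_real (cosh y)"
  by (simp add: cosh_def exp_of_real[symmetric] scaleR_conv_of_real)

lemma cosh_ii_times_of_real: "cosh (\<i> * of_nat n * complex_of_real u) = of_real (cos (real n * u))"
proof -
  have "\<i> * (\<i> * of_nat n * complex_of_real u) = - of_real (real n * u)"
    by (simp add: complex_eq_iff)
  thus ?thesis by (simp only: cosh_conv_cos cos_minus cos_of_real)
qed

lemma macdonald_K_eq_bessel_K: "macdonald_K (\<i> * of_nat n) x = of_real (bessel_K (real n) x)"
  unfolding macdonald_K_def bessel_K_def cosh_ii_times_of_real of_real_mult[symmetric]
  by (simp only: set_integral_complex_of_real mult_minus_left)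

lemma K_c_eq_trunc_K: "K_c x (\<i> * of_nat n) pi = of_real (trunc_K (real n) x)"
proof -
  have "cos (complex_of_real pi * (\<i> * of_nat n) / 2) = of_real (cosh (pi * real n / 2))"
  proof -
    have "complex_of_real pi * (\<i> * of_nat n) / 2 = \<i> * of_real (pi * real n / 2)" by simp
    thus ?thesis
      by (simp only: cosh_conv_cos[symmetric] cosh_complex_of_real)
  qed
  moreover have "(LBINT u=0..pi. complex_of_real (cos (x * sinh u)) * cosh (\<i> * of_nat n * complex_of_real u)) =
     of_real (LBINT u:{0..pi}. cos (x * sinh u) * cos (real n * u))"
    unfolding cosh_ii_times_of_real of_real_mult[symmetric] zero_ereal_def
    by (simp only: interval_integral_Icc pi_ge_zero set_integral_complex_of_real)
  ultimately show ?thesis by (simp add: K_c_def trunc_K_def)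
qed

section \<open>Integrability of the Macdonald function\<close>

lemma cosh_real_ge_self: "cosh u \<ge> (u::real)"
proof -
  have "u \<le> exp u / 2" 
  proof (cases "u \<ge> 0")
    case True
    thus ?thesis using exp_lower_Taylor_quadratic[of u] sum_squares_ge_zero[of "u - 1" 0]
      by (auto simp: power2_eq_square algebra_simps)
  next
    case False
    thus ?thesis by (meson exp_ge_zero divide_nonneg_pos zero_less_numeral linear order_trans)
  qed
  thus ?thesis by (simp add: cosh_def) (smt (verit) exp_gt_zero)
qed

lemma inverse_cosh_le: "1 / cosh u \<le> 2 * exp (- (u::real))"
proof -
  have "exp u \<le> 2 * cosh u" by (simp add: cosh_def)
  thus ?thesis by (simp add: exp_minus field_simps)
qed

lemma set_integrable_exp_neg:
  fixes c :: real assumes "c > 0"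
  shows "set_integrable lborel {0<..} (\<lambda>x. exp (- (c * x)))" "(LBINT x:{0<..}. exp (- (c * x))) = 1 / c"
proof -
  have lim: "((\<lambda>x. - exp (- (c * x)) / c) \<longlongrightarrow> 0) at_top" using assms by real_asymp
  have lim0: "((\<lambda>x. - exp (- (c * x)) / c) \<longlongrightarrow> - 1 / c) (at_right 0)"
    using assms by (real_asymp, simp add: field_simps)
  have D: "((\<lambda>x. - exp (- (c * x)) / c) has_real_derivative exp (- (c * x))) (at x)" for x
    using assms by (auto intro!: derivative_eq_intros)
  have ei: "einterval 0 \<infinity> = {0<..}" by (auto simp: einterval_def zero_ereal_def)
  note * = interval_integral_FTC_nonneg[of 0 \<infinity> "\<lambda>x. - exp (- (c * x)) / c" "\<lambda>x. exp (- (c * x))" "- 1 / c" 0, OF _ D]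
  show "set_integrable lborel {0<..} (\<lambda>x. exp (- (c * x)))"
    by (rule *(1)[unfolded ei]) (use lim lim0 in \<open>auto simp: zero_ereal_def ereal_tendsto_simps\<close>)
  have "(LBINT x=0..\<infinity>. exp (- (c * x))) = 0 - - 1 / c"
    by (rule *(2)) (use lim lim0 in \<open>auto simp: zero_ereal_def ereal_tendsto_simps\<close>)
  thus "(LBINT x:{0<..}. exp (- (c * x))) = 1 / c"
    by (simp add: interval_lebesgue_integral_le_eq ei)
qed

lemma integral_exp_neg_times_sin:
  fixes c s :: real assumes c: "c > 0"
  shows "(LBINT x:{0<..}. exp (- (c * x)) * sin (x * s)) = s / (c\<^sup>2 + s\<^sup>2)"
proof -
  define F where "F x = - exp (- (c * x)) * (c * sin (x * s) + s * cos (x * s)) / (c\<^sup>2 + s\<^sup>2)" for x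
  have ei: "einterval 0 \<infinity> = {0<..}" by (auto simp: einterval_def zero_ereal_def)
  have nz: "c\<^sup>2 + s\<^sup>2 \<noteq> 0" using c by (simp add: add_nonneg_eq_0_iff)
  have D: "(F has_real_derivative exp (- (c * x)) * sin (x * s)) (at x)" for x
  proof -
    have "((\<lambda>x. - exp (- (c * x)) * (c * sin (x * s) + s * cos (x * s))) has_real_derivative
            exp (- (c * x)) * sin (x * s) * (c\<^sup>2 + s\<^sup>2)) (at x)"
      by (auto intro!: derivative_eq_intros simp: algebra_simps power2_eq_square)
    from DERIV_cdivide[OF this, of "c\<^sup>2 + s\<^sup>2"] show ?thesis using nz by (simp add: F_def[abs_def] split: if_splits)
  qed
  have lim: "(F \<longlongrightarrow> 0) at_top"
  proof (rule Lim_null_comparison)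
    show "\<forall>\<^sub>F x in at_top. norm (F x) \<le> exp (- (c * x)) * (c + \<bar>s\<bar>) / (c\<^sup>2 + s\<^sup>2)"
    proof (intro always_eventually allI)
      fix x
      have "\<bar>c * sin (x * s)\<bar> \<le> c" using c abs_sin_le_one[of "x * s"] by (simp add: abs_mult)
      moreover have "\<bar>s * cos (x * s)\<bar> \<le> \<bar>s\<bar>" using abs_cos_le_one[of "x * s"] by (simp add: abs_mult mult_left_le)
      ultimately have "\<bar>c * sin (x * s) + s * cos (x * s)\<bar> \<le> c + \<bar>s\<bar>" by linarith
      thus "norm (F x) \<le> exp (- (c * x)) * (c + \<bar>s\<bar>) / (c\<^sup>2 + s\<^sup>2)"
        using nz by (auto simp: F_def abs_mult intro!: divide_right_mono mult_left_mono)
    qed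
    show "((\<lambda>x. exp (- (c * x)) * (c + \<bar>s\<bar>) / (c\<^sup>2 + s\<^sup>2)) \<longlongrightarrow> 0) at_top"
      using c by real_asymp
  qed
  have "isCont F 0" using D DERIV_isCont by blast
  hence lim0: "(F \<longlongrightarrow> - s / (c\<^sup>2 + s\<^sup>2)) (at_right 0)"
    by (auto simp: isCont_def F_def intro: filterlim_mono[OF _ order_refl at_le])
  have int: "set_integrable lborel {0<..} (\<lambda>x. exp (- (c * x)) * sin (x * s))"
    using set_integrable_exp_neg(1)[OF c]
    by (rule set_integrable_bound) (auto simp: set_borel_measurable_def abs_mult mult_left_le)
  have "(LBINT x=0..\<infinity>. exp (- (c * x)) * sin (x * s)) = 0 - - s / (c\<^sup>2 + s\<^sup>2)"
    by (rule interval_integral_FTC_integrable[of 0 \<infinity> F])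
      (use D lim lim0 int in \<open>auto simp: ei zero_ereal_def ereal_tendsto_simps
         has_real_derivative_iff_has_vector_derivative intro!: continuous_intros\<close>)
  thus ?thesis by (simp add: interval_lebesgue_integral_le_eq ei)
qed

lemma integrable_inverse_cosh: "set_integrable lborel {0..} (\<lambda>u::real. 1 / cosh u)"
proof (rule set_integrable_bound)
  have "set_integrable lborel {0<..} (\<lambda>u::real. exp (- (1 * u)))" by (rule set_integrable_exp_neg) simp
  hence "set_integrable lborel {0..} (\<lambda>u::real. exp (- (1 * u)))"
    unfolding set_integrable_def
    by (subst integrable_cong_AE[where g = "\<lambda>u. indicator {0<..} u *\<^sub>R exp (- (1 * u))"])
       (auto intro!: AE_I[of _ _ "{0}"] simp: indicator_def)
  thus "set_integrable lborel {0..} (\<lambda>u::real. 2 * exp (- u))" by simp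
qed (auto simp: set_borel_measurable_def inverse_cosh_le abs_mult)

lemma set_integrable_exp_cosh:
  fixes x :: real assumes "x > 0"
  shows "set_integrable lborel {0..} (\<lambda>u. exp (- (x * cosh u)))"
proof (rule set_integrable_bound)
  show "set_integrable lborel {0..} (\<lambda>u. (1 / x) * (1 / cosh u))"
    using integrable_inverse_cosh by (rule set_integrable_mult_right)
  have "exp (- (x * cosh u)) \<le> 1 / x * (1 / cosh u)" for u :: real
  proof -
    have p: "x * cosh u > 0" using assms by simp
    have "x * cosh u \<le> exp (x * cosh u)" by (smt (verit) exp_ge_add_one_self)
    thus ?thesis using p by (simp add: exp_minus field_simps)
  qed
  thus "AE u in lborel. u \<in> {0..} \<longrightarrow> norm (exp (- (x * cosh u))) \<le> norm (1 / x * (1 / cosh u))"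
    using assms by (auto simp: abs_mult)
qed (auto simp: set_borel_measurable_def)

lemma set_integrable_exp_cosh_cos:
  fixes x :: real assumes "x > 0"
  shows "set_integrable lborel {0..} (\<lambda>u. exp (- (x * cosh u)) * cos (\<nu> * u))"
  using set_integrable_exp_cosh[OF assms]
  by (rule set_integrable_bound) (auto simp: set_borel_measurable_def abs_mult mult_left_le)

lemma abs_bessel_K_le:
  assumes "x > 0"
  shows "\<bar>bessel_K \<nu> x\<bar> \<le> bessel_K 0 x"
proof -
  have "norm (bessel_K \<nu> x) \<le> (LBINT u:{0..}. norm (exp (- (x * cosh u)) * cos (\<nu> * u)))"
    unfolding bessel_K_def by (rule set_integral_norm_bound[OF set_integrable_exp_cosh_cos[OF assms]])
  also have "\<dots> \<le> bessel_K 0 x"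
    unfolding bessel_K_def using set_integrable_exp_cosh[OF assms] set_integrable_exp_cosh_cos[OF assms]
    by (intro set_integral_mono set_integrable_norm) (auto simp: abs_mult mult_left_le)
  finally show ?thesis by simp
qed

text \<open>Integrating over \<open>x\<close> first leaves \<open>1 / (c cosh u)\<close>, which is integrable. This gives both the
  integrability of \<open>K\<^sub>0\<close> and the domination needed to apply Fubini to the sine transform of \<open>K\<^sub>m\<close>.\<close>

lemma integrable_exp_cosh_prod:
  fixes c :: real assumes c: "c > 0"
  shows "integrable (lborel \<Otimes>\<^sub>M lborel)
           (\<lambda>(u, x). indicator {0..} u * (indicator {0<..} x * exp (- (c * cosh u * x))) :: real)"
    (is "integrable _ ?f")
proof (rule lborel_pair.Fubini_integrable)
  have *: "integrable lborel (\<lambda>x. indicator {0<..} x * exp (- (c * cosh u * x)) :: real)"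
    "(\<integral>x. indicator {0<..} x * exp (- (c * cosh u * x)) \<partial>lborel) = 1 / (c * cosh u)" for u :: real
    using set_integrable_exp_neg[of "c * cosh u"] c by (simp_all add: set_integrable_def set_lebesgue_integral_def)
  show "AE u in lborel. integrable lborel (\<lambda>x. ?f (u, x))"
    using * by auto
  have "(\<integral>x. norm (?f (u, x)) \<partial>lborel) = (1 / c) * (indicator {0..} u * (1 / cosh u))" for u
  proof -
    have "(\<integral>x. norm (?f (u, x)) \<partial>lborel) = (\<integral>x. ?f (u, x) \<partial>lborel)"
      by (intro Bochner_Integration.integral_cong) (auto simp: abs_mult)
    thus ?thesis using *(2) by simp
  qed
  moreover have "integrable lborel (\<lambda>u. (1 / c) * (indicator {0..} u * (1 / cosh u)) :: real)"
    using integrable_inverse_cosh unfolding set_integrable_def by (intro integrable_mult_right) simp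
  ultimately show "integrable lborel (\<lambda>u. \<integral>x. norm (?f (u, x)) \<partial>lborel)"
    by simp
qed measurable

lemma set_integrable_bessel_K_0:
  assumes "c > 0"
  shows "set_integrable lborel {0<..} (\<lambda>x. bessel_K 0 (c * x))"
proof -
  have "integrable lborel (\<lambda>x. \<integral>u. indicator {0..} u * (indicator {0<..} x * exp (- (c * cosh u * x))) \<partial>lborel)"
    by (rule lborel_pair.integrable_snd) (rule integrable_exp_cosh_prod[OF assms])
  also have "(\<lambda>x. \<integral>u. indicator {0..} u * (indicator {0<..} x * exp (- (c * cosh u * x))) \<partial>lborel) = 
       (\<lambda>x. indicator {0<..} x *\<^sub>R bessel_K 0 (c * x))"
    by (intro ext) (auto simp: bessel_K_def set_lebesgue_integral_def mult_ac indicator_def)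
  finally show ?thesis by (simp add: set_integrable_def)
qed

lemma borel_measurable_bessel_K [measurable]: "bessel_K \<nu> \<in> borel_measurable borel"
  unfolding bessel_K_def[abs_def] set_lebesgue_integral_def by measurable

lemma borel_measurable_trunc_K [measurable]: "trunc_K \<nu> \<in> borel_measurable borel"
  unfolding trunc_K_def[abs_def] set_lebesgue_integral_def by measurable

section \<open>Integration by parts in the truncated kernel\<close>

text \<open>The boundary terms vanish because \<open>sin (n\<pi>) = 0\<close>, which needs \<open>n\<close> to be an integer and is the
  reason for the cut-off \<open>\<pi>\<close>. The factor \<open>x\<close> that appears cancels the \<open>1/x\<close> of the measure \<open>dx/x\<close>, and
  the factor \<open>1/n\<close> is the one in the weaker summability condition.\<close>

lemma trunc_K_by_parts:
  assumes n: "n \<ge> (1::nat)"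
  shows "trunc_K n x = x / (n * cosh (pi * n / 2)) * (LBINT u:{0..pi}. cosh u * sin (x * sinh u) * sin (real n * u))"
proof -
  define f where "f u = cos (x * sinh u) * cos (real n * u)" for u :: real
  define g where "g u = cosh u * sin (x * sinh u) * sin (real n * u)" for u :: real
  have f: "set_integrable lborel {0..pi} f" unfolding f_def
    by (intro borel_integrable_atLeastAtMost' continuous_intros)
  have g: "set_integrable lborel {0..pi} g" unfolding g_def
    by (intro borel_integrable_atLeastAtMost' continuous_intros)
  have "(LBINT u:{0..pi}. f u - (x / n) * g u) =
     cos (x * sinh pi) * sin (real n * pi) / n - cos (x * sinh 0) * sin (real n * 0) / n"
    unfolding set_lebesgue_integral_def
  proof (rule integral_FTC_atLeastAtMost)
    fix u :: real
    have "((\<lambda>u. cos (x * sinh u) * sin (real n * u) / n) has_real_derivative f u - (x / n) * g u) (at u within {0..pi})"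
      using n unfolding f_def g_def by (auto intro!: derivative_eq_intros simp: field_simps)
    thus "((\<lambda>u. cos (x * sinh u) * sin (real n * u) / n) has_vector_derivative f u - (x / n) * g u) (at u within {0..pi})"
      by (simp add: has_real_derivative_iff_has_vector_derivative)
  next
    show "continuous_on {0..pi} (\<lambda>u. f u - (x / n) * g u)"
      unfolding f_def g_def by (intro continuous_intros)
  qed simp
  also have "\<dots> = 0" by (simp add: sin_npi)
  also have "(LBINT u:{0..pi}. f u - (x / n) * g u) = (LBINT u:{0..pi}. f u) - (x / n) * (LBINT u:{0..pi}. g u)"
    using f g by (subst set_integral_diff) auto
  finally show ?thesis by (simp add: trunc_K_def f_def g_def field_simps)
qed

lemma abs_trunc_K_le:
  assumes n: "n \<ge> (1::nat)" and x: "x > 0"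
  shows "\<bar>trunc_K n x\<bar> \<le> 2 * sinh pi * (exp (- pi * n / 2) / n) * x"
proof -
  have g: "set_integrable lborel {0..pi} (\<lambda>u. cosh u * sin (x * sinh u) * sin (real n * u))"
    by (intro borel_integrable_atLeastAtMost' continuous_intros)
  have "norm (LBINT u:{0..pi}. cosh u * sin (x * sinh u) * sin (real n * u)) \<le>
      (LBINT u:{0..pi}. norm (cosh u * sin (x * sinh u) * sin (real n * u)))"
    by (rule set_integral_norm_bound[OF g])
  also have "\<dots> \<le> (LBINT u:{0..pi}. cosh u)"
  proof (intro set_integral_mono set_integrable_norm g)
    show "set_integrable lborel {0..pi} (cosh :: real \<Rightarrow> real)"
      by (intro borel_integrable_atLeastAtMost' continuous_intros)
    fix u :: real
    have "\<bar>sin (x * sinh u)\<bar> * \<bar>sin (real n * u)\<bar> \<le> 1" by (intro mult_le_one) auto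
    thus "norm (cosh u * sin (x * sinh u) * sin (real n * u)) \<le> cosh u"
      by (simp add: abs_mult mult.assoc mult_left_le)
  qed
  also have "\<dots> = sinh pi - sinh 0"
    unfolding set_lebesgue_integral_def
    by (rule integral_FTC_atLeastAtMost)
      (auto intro!: derivative_eq_intros continuous_intros simp: has_real_derivative_iff_has_vector_derivative[symmetric])
  finally have "\<bar>LBINT u:{0..pi}. cosh u * sin (x * sinh u) * sin (real n * u)\<bar> \<le> sinh pi" by simp
  hence "\<bar>trunc_K n x\<bar> \<le> x / (n * cosh (pi * n / 2)) * sinh pi"
    unfolding trunc_K_by_parts[OF n] using x by (auto simp: abs_mult intro!: divide_right_mono mult_left_mono)
  also have "\<dots> = (1 / cosh (pi * n / 2)) * (x * sinh pi / n)" by simp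
  also have "\<dots> \<le> (2 * exp (- (pi * n / 2))) * (x * sinh pi / n)"
    using x by (intro mult_right_mono inverse_cosh_le) auto
  finally show ?thesis by (simp add: algebra_simps)
qed

section \<open>Exponential decay of the Macdonald function in the order\<close>

lemma Re_Im_cosh:
  "Re (cosh (Complex t s)) = cosh t * cos s" "Im (cosh (Complex t s)) = sinh t * sin s"
  by (auto simp: cosh_def sinh_def Re_exp Im_exp algebra_simps add_divide_distrib diff_divide_distrib)

lemma abs_sinh_le_norm_cosh: "norm (cosh (Complex t s)) \<ge> \<bar>sinh t\<bar>"
proof (rule power2_le_imp_le)
  have "(norm (cosh (Complex t s)))\<^sup>2 = (cosh t)\<^sup>2 * (cos s)\<^sup>2 + (sinh t)\<^sup>2 * (sin s)\<^sup>2"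
    unfolding cmod_power2 Re_Im_cosh by (simp add: power_mult_distrib)
  also have "\<dots> = (sinh t)\<^sup>2 + (cos s)\<^sup>2"
    by (simp add: cosh_square_eq sin_squared_eq algebra_simps)
  finally show "\<bar>sinh t\<bar>\<^sup>2 \<le> (norm (cosh (Complex t s)))\<^sup>2" by simp
qed simp

lemma integral_even_function:
  fixes f :: "real \<Rightarrow> 'a :: {banach, second_countable_topology}"
  assumes "set_integrable lborel {0..} f" "\<And>t. f (- t) = f t"
  shows "integrable lborel f" "(\<integral>t. f t \<partial>lborel) = 2 *\<^sub>R (LBINT t:{0..}. f t)"
proof -
  have "has_bochner_integral lborel f (2 *\<^sub>R (LBINT t:{0..}. f t))"
    using assms by (intro has_bochner_integral_even_function)
      (auto simp: set_integrable_def set_lebesgue_integral_def has_bochner_integral_integrable)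
  thus "integrable lborel f" "(\<integral>t. f t \<partial>lborel) = 2 *\<^sub>R (LBINT t:{0..}. f t)"
    by (auto simp: has_bochner_integral_iff)
qed

text \<open>Moving the line of integration up by \<open>\<delta> < \<pi>/2\<close> trades decay in \<open>x\<close> for the factor \<open>exp (-\<delta>m)\<close>.\<close>

lemma abs_bessel_K_le_exp:
  assumes m: "m \<ge> 0" and d: "0 \<le> \<delta>" "\<delta> < pi / 2" and x: "x > 0"
  shows "\<bar>bessel_K m x\<bar> \<le> exp (- \<delta> * m) * bessel_K 0 (cos \<delta> * x)"
proof -
  define f where "f z = exp (- of_real x * cosh z + \<i> * of_real m * z)" for z
  have cosd: "cos \<delta> > 0" using d by (intro cos_gt_zero_pi) auto
  have nf: "norm (f (Complex t s)) = exp (- (x * cos s * cosh t) - m * s)" for t s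
    unfolding f_def by (simp add: Re_Im_cosh mult_ac)
  have nf': "norm (f (of_real t + \<i> * of_real s)) = exp (- m * s) * exp (- (x * cos s * cosh t))" for t s
    using nf[of t s] by (simp add: Complex_eq exp_diff exp_minus field_simps)
  have Ref: "Re (f (of_real t)) = exp (- (x * cosh t)) * cos (m * t)" for t
    unfolding f_def by (simp add: Re_exp Re_Im_cosh complex_of_real_def)
  have holo: "f holomorphic_on A" for A unfolding f_def cosh_conv_cos by (intro holomorphic_intros)
  have contf: "continuous_on UNIV f" using holo holomorphic_on_imp_continuous_on by blast
  have meas: "(\<lambda>t. f (of_real t + c)) \<in> borel_measurable borel" for c
    by (intro borel_measurable_continuous_onI continuous_on_compose2[OF contf] continuous_intros) auto
  have E: "integrable lborel (\<lambda>t. exp (- (y * cosh t)))"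
     "(\<integral>t. exp (- (y * cosh t)) \<partial>lborel) = 2 * bessel_K 0 y" if "y > 0" for y
    using integral_even_function[OF set_integrable_exp_cosh[OF that]] by (simp_all add: bessel_K_def)
  have int: "integrable lborel (\<lambda>t. f (of_real t + \<i> * of_real s))" if "cos s > 0" for s
  proof (rule Bochner_Integration.integrable_bound)
    show "integrable lborel (\<lambda>t. exp (- m * s) * exp (- (x * cos s * cosh t)))"
      using E(1)[of "x * cos s"] x that by simp
    from nf' show "AE t in lborel. norm (f (of_real t + \<i> * of_real s)) \<le> norm (exp (- m * s) * exp (- (x * cos s * cosh t)))"
      by simp
  qed (use meas in simp)
  have "(\<integral>t. f (of_real t) \<partial>lborel) - (\<integral>t. f (of_real t + \<i> * of_real \<delta>) \<partial>lborel) = 2 * pi * \<i> * (\<Sum>p\<in>{}. residue f p)"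
  proof (rule strip_residue_theorem[where \<epsilon> = 1 and B = "\<lambda>R. exp (- (x * cos \<delta> * R))" and ?R0.0 = 0])
    fix R s :: real assume R: "R \<ge> 0" and s: "0 \<le> s" "s \<le> \<delta>"
    have "cos \<delta> \<le> cos s" using s d by (intro cos_monotone_0_pi_le) auto
    hence "x * cos \<delta> * R \<le> x * cos s * cosh R"
      using x R cosd by (intro mult_mono cosh_real_ge_self) auto
    thus "norm (f (Complex R s)) \<le> exp (- (x * cos \<delta> * R)) \<and> norm (f (Complex (- R) s)) \<le> exp (- (x * cos \<delta> * R))"
      using mult_nonneg_nonneg[OF m s(1)] unfolding nf by simp
  next
    show "((\<lambda>R. exp (- (x * cos \<delta> * R))) \<longlongrightarrow> 0) at_top"
    proof -
      have "((\<lambda>R. exp (- (y * R))) \<longlongrightarrow> 0) at_top" if "y > 0" for y :: real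
        using that by real_asymp
      thus ?thesis using mult_pos_pos[OF x cosd] by blast
    qed
  qed (use d int[of 0] int[of \<delta>] cosd holo in auto)
  hence eq: "(\<integral>t. f (of_real t) \<partial>lborel) = (\<integral>t. f (of_real t + \<i> * of_real \<delta>) \<partial>lborel)" by simp
  have "2 * bessel_K m x = (\<integral>t. Re (f (of_real t)) \<partial>lborel)"
    unfolding Ref bessel_K_def
    using integral_even_function(2)[OF set_integrable_exp_cosh_cos[OF x, of m]] by simp
  also have "\<dots> = Re (\<integral>t. f (of_real t) \<partial>lborel)"
    using int[of 0] by simp
  finally have "\<bar>2 * bessel_K m x\<bar> \<le> norm (\<integral>t. f (of_real t) \<partial>lborel)"
    using abs_Re_le_cmod by simp
  also have "\<dots> \<le> (\<integral>t. norm (f (of_real t + \<i> * of_real \<delta>)) \<partial>lborel)"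
    unfolding eq by (rule integral_norm_bound)
  also have "(\<lambda>t. norm (f (of_real t + \<i> * of_real \<delta>))) = (\<lambda>t. exp (- \<delta> * m) * exp (- (cos \<delta> * x * cosh t)))"
    by (simp add: nf' mult_ac)
  also have "(\<integral>t. exp (- \<delta> * m) * exp (- (cos \<delta> * x * cosh t)) \<partial>lborel) = exp (- \<delta> * m) * (2 * bessel_K 0 (cos \<delta> * x))"
    using E(2)[of "cos \<delta> * x"] x cosd by simp
  finally show ?thesis by simp
qed

section \<open>The sine transform of the Macdonald function\<close>

text \<open>Fubini, followed by the Laplace transform of the sine.\<close>

lemma bessel_K_sine_transform_eq:
  "(LBINT x:{0<..}. bessel_K m x * sin (x * s)) = (LBINT t:{0..}. cos (m * t) * (s / ((cosh t)\<^sup>2 + s\<^sup>2)))"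
proof -
  define f where "f u x = indicator {0..} u * (indicator {0<..} x * exp (- (1 * cosh u * x))) * (cos (m * u) * sin (x * s))"
    for u x :: real
  have "integrable (lborel \<Otimes>\<^sub>M lborel) (\<lambda>(u, x). f u x)"
  proof (rule Bochner_Integration.integrable_bound[OF integrable_exp_cosh_prod[of 1]])
    have "\<bar>cos (m * u) * sin (x * s)\<bar> \<le> 1" for u x
      unfolding abs_mult by (intro mult_le_one) auto
    thus "AE p in lborel \<Otimes>\<^sub>M lborel. norm ((\<lambda>(u, x). f u x) p) \<le>
        norm ((\<lambda>(u, x). indicator {0..} u * (indicator {0<..} x * exp (- (1 * cosh u * x))) :: real) p)"
      by (intro AE_I2) (auto simp: f_def abs_mult mult_left_le split: prod.split)
  qed (auto simp: f_def)
  from lborel_pair.Fubini_integral[OF this]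
  have "(\<integral>x. (\<integral>u. f u x \<partial>lborel) \<partial>lborel) = (\<integral>u. (\<integral>x. f u x \<partial>lborel) \<partial>lborel)" .
  moreover have "(\<integral>u. f u x \<partial>lborel) = indicator {0<..} x *\<^sub>R (bessel_K m x * sin (x * s))" for x
  proof -
    have "(\<integral>u. f u x \<partial>lborel) = (\<integral>u. (indicator {0<..} x * sin (x * s)) * (indicator {0..} u *\<^sub>R (exp (- (x * cosh u)) * cos (m * u))) \<partial>lborel)"
      by (intro Bochner_Integration.integral_cong) (auto simp: f_def mult_ac)
    thus ?thesis by (simp add: bessel_K_def set_lebesgue_integral_def)
  qed
  moreover have "(\<integral>x. f u x \<partial>lborel) = indicator {0..} u *\<^sub>R (cos (m * u) * (s / ((cosh u)\<^sup>2 + s\<^sup>2)))" for u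
  proof -
    have "(\<integral>x. f u x \<partial>lborel) = (\<integral>x. (indicator {0..} u * cos (m * u)) * (indicator {0<..} x *\<^sub>R (exp (- (cosh u * x)) * sin (x * s))) \<partial>lborel)"
      by (intro Bochner_Integration.integral_cong) (auto simp: f_def mult_ac)
    also have "\<dots> = (indicator {0..} u * cos (m * u)) * (LBINT x:{0<..}. exp (- (cosh u * x)) * sin (x * s))"
      by (simp add: set_lebesgue_integral_def)
    finally show ?thesis by (simp add: integral_exp_neg_times_sin)
  qed
  ultimately show ?thesis by (simp add: set_lebesgue_integral_def)
qed

lemma residue_quotient_simple_zero:
  assumes S: "open S" "z \<in> S" and g: "g holomorphic_on S" and h: "h holomorphic_on S"
    and nz: "\<And>w. w \<in> S \<Longrightarrow> w \<noteq> z \<Longrightarrow> h w \<noteq> 0" and hz: "h z = 0"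
    and d: "(h has_field_derivative d) (at z)" "d \<noteq> 0"
  shows "residue (\<lambda>w. g w / h w) z = g z / d"
proof (rule residue_simple'[OF S])
  show "(\<lambda>w. g w / h w) holomorphic_on S - {z}"
    using nz by (intro holomorphic_intros holomorphic_on_subset[OF g] holomorphic_on_subset[OF h]) auto
  have "(g \<longlongrightarrow> g z) (at z)"
    using g S by (metis holomorphic_on_imp_continuous_on continuous_on_eq_continuous_at isCont_def)
  moreover have "((\<lambda>w. (h w - h z) / (w - z)) \<longlongrightarrow> d) (at z)"
    using d(1) by (simp add: has_field_derivative_iff)
  ultimately have "((\<lambda>w. g w / ((h w - h z) / (w - z))) \<longlongrightarrow> g z / d) (at z)"
    by (intro tendsto_divide d(2))
  thus "((\<lambda>w. g w / h w * (w - z)) \<longlongrightarrow> g z / d) (at z)"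
    by (simp add: hz)
qed

lemma cosh_eq_0_in_strip:
  assumes "cosh w = 0" "-1 < Im w" "Im w < pi + 1"
  shows "w = \<i> * of_real pi / 2"
proof -
  obtain t s where w: "w = Complex t s" by (cases w)
  have 1: "cosh t * cos s = 0" "sinh t * sin s = 0"
    using Re_Im_cosh[of t s] assms(1) w by auto
  hence c: "cos s = 0" by simp
  hence "sin s \<noteq> 0" using sin_cos_squared_add[of s] by auto
  hence t: "t = 0" using 1 by simp
  have "s = pi / 2"
  proof (rule linorder_cases)
    assume "s < pi / 2"
    hence "cos s > 0" using assms w pi_ge_two by (intro cos_gt_zero_pi) auto
    thus ?thesis using c by simp
  next
    assume "s > pi / 2"
    hence "cos (s - pi) > 0" using assms w pi_ge_two by (intro cos_gt_zero_pi) auto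
    thus ?thesis using c by (simp add: cos_diff)
  qed
  thus ?thesis using w t by (simp add: complex_eq_iff)
qed

lemma cosh_sinh_plus_ii_pi_half:
  "cosh (\<i> * of_real pi / 2 + z) = \<i> * sinh z" "sinh (\<i> * of_real pi / 2 + z) = \<i> * cosh z"
proof -
  have e: "exp (\<i> * of_real pi / 2) = \<i>"
    using cis_pi_half by (simp add: cis_conv_exp)
  have "cosh (\<i> * complex_of_real pi / 2) = 0" "sinh (\<i> * complex_of_real pi / 2) = \<i>"
    unfolding cosh_def sinh_def exp_minus e by (simp_all add: complex_eq_iff)
  thus "cosh (\<i> * of_real pi / 2 + z) = \<i> * sinh z" "sinh (\<i> * of_real pi / 2 + z) = \<i> * cosh z"
    by (simp_all only: cosh_add sinh_add mult_zero_left add_0_left add_0_right)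
qed

lemma sinh_real_ge_self:
  assumes "x \<ge> (0::real)" shows "x \<le> sinh x"
proof -
  have "(\<lambda>x. sinh x - x) 0 \<le> (\<lambda>x. sinh x - x) x"
  proof (rule DERIV_nonneg_imp_nondecreasing[OF assms])
    fix y :: real
    have "((\<lambda>x. sinh x - x) has_real_derivative cosh y - 1) (at y)"
      by (auto intro!: derivative_eq_intros)
    thus "\<exists>d. ((\<lambda>x. sinh x - x) has_real_derivative d) (at y) \<and> 0 \<le> d"
      using cosh_real_ge_1[of y] by (intro exI[of _ "cosh y - 1"]) simp
  qed
  thus ?thesis by simp
qed

text \<open>The integrand is multiplied by \<open>exp (-\<pi>m)\<close> under the shift by \<open>\<i>\<pi>\<close>, so the two edges of the strip
  of height \<open>\<pi>\<close> carry multiples of the same integral. The strip contains the simple poles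
  \<open>\<i>\<pi>/2 - u\<close> and \<open>\<i>\<pi>/2 + u\<close>.\<close>

lemma integral_exp_div_cosh_cosh:
  assumes m: "m > 0" and u: "u > 0"
  defines "f \<equiv> \<lambda>z. exp (\<i> * of_real m * z) / (cosh (z + of_real u) * cosh (z - of_real u))"
  shows "integrable lborel (\<lambda>t. f (of_real t))"
    and "(\<integral>t. f (of_real t) \<partial>lborel) = of_real (2 * pi * sin (m * u) / (sinh (pi * m / 2) * sinh (2 * u)))"
proof -
  define p q where "p = \<i> * of_real pi / 2 - of_real u" and "q = \<i> * of_real pi / 2 + of_real u"
  define S where "S = {z::complex. -1 < Im z \<and> Im z < pi + 1}"
  have S_eq: "S = {z. Im z > -1} \<inter> {z. Im z < pi + 1}" by (auto simp: S_def)
  have openS: "open S" unfolding S_eq by (intro open_Int open_halfspace_Im_gt open_halfspace_Im_lt)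
  have pq: "p \<in> S" "q \<in> S" "p \<noteq> q" using u pi_ge_two by (auto simp: S_def p_def q_def complex_eq_iff)
  have zeros: "z = p \<or> z = q" if "z \<in> S" "cosh (z + of_real u) * cosh (z - of_real u) = 0" for z
  proof -
    have "z + of_real u = \<i> * of_real pi / 2 \<or> z - of_real u = \<i> * of_real pi / 2"
      using that cosh_eq_0_in_strip[of "z + of_real u"] cosh_eq_0_in_strip[of "z - of_real u"]
      by (auto simp: S_def)
    thus ?thesis unfolding p_def q_def by (metis add_diff_cancel diff_add_cancel)
  qed
  have hol: "(\<lambda>z. cosh (z + of_real u) * cosh (z - of_real u)) holomorphic_on A" 
    "(\<lambda>z. exp (\<i> * of_real m * z)) holomorphic_on A" for A
    unfolding cosh_conv_cos by (intro holomorphic_intros)+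
  have D: "((\<lambda>z. cosh (z + of_real u) * cosh (z - of_real u)) has_field_derivative
         sinh (z + of_real u) * cosh (z - of_real u) + sinh (z - of_real u) * cosh (z + of_real u)) (at z)" for z :: complex
    by (auto intro!: derivative_eq_intros)
  have sh: "sinh (2 * complex_of_real u) = of_real (sinh (2 * u))"
    by (simp add: sinh_def exp_of_real[symmetric] scaleR_conv_of_real)
  have sh0: "sinh (2 * u) > 0" using u by simp
  have p_vals: "cosh (p + of_real u) = 0" "sinh (p + of_real u) = \<i>" "cosh (p - of_real u) = - \<i> * of_real (sinh (2 * u))"
    using cosh_sinh_plus_ii_pi_half[of 0] cosh_sinh_plus_ii_pi_half(1)[of "- (2 * of_real u)"] sh
    by (simp_all add: p_def)
  have q_vals: "cosh (q - of_real u) = 0" "sinh (q - of_real u) = \<i>" "cosh (q + of_real u) = \<i> * of_real (sinh (2 * u))"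
    using cosh_sinh_plus_ii_pi_half[of 0] cosh_sinh_plus_ii_pi_half(1)[of "2 * of_real u"] sh
    by (simp_all add: q_def add.assoc)
  have res_p: "residue f p = exp (\<i> * of_real m * p) / of_real (sinh (2 * u))"
    unfolding f_def
    by (rule residue_quotient_simple_zero[of "S - {q}", OF _ _ hol(2) hol(1) _ _ DERIV_cong[OF D]])
       (use openS pq zeros p_vals sh0 in \<open>auto intro: open_delete\<close>)
  have res_q: "residue f q = exp (\<i> * of_real m * q) / (- of_real (sinh (2 * u)))"
    unfolding f_def
    by (rule residue_quotient_simple_zero[of "S - {p}", OF _ _ hol(2) hol(1) _ _ DERIV_cong[OF D]])
       (use openS pq zeros q_vals sh0 in \<open>auto intro: open_delete\<close>)
  have e_pq: "exp (\<i> * of_real m * p) - exp (\<i> * of_real m * q) = - 2 * \<i> * of_real (sin (m * u) * exp (- (pi * m / 2)))"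
    by (simp add: p_def q_def complex_eq_iff Re_exp Im_exp)
  have holo: "f holomorphic_on S - {p, q}"
    unfolding f_def using zeros by (intro holomorphic_on_divide hol) auto
  have per: "f (z + \<i> * of_real pi) = of_real (exp (- (pi * m))) * f z" for z
  proof -
    have c: "cosh (w + \<i> * of_real pi) = - cosh w" for w :: complex
      by (simp add: cosh_def exp_add exp_diff exp_minus scaleR_conv_of_real field_simps)
    have "cosh (z + \<i> * of_real pi + of_real u) = - cosh (z + of_real u)"
       "cosh (z + \<i> * of_real pi - of_real u) = - cosh (z - of_real u)"
      using c[of "z + of_real u"] c[of "z - of_real u"] by (simp_all add: algebra_simps)
    moreover have "exp (\<i> * of_real m * (z + \<i> * of_real pi)) = of_real (exp (- (pi * m))) * exp (\<i> * of_real m * z)"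
      by (simp add: exp_of_real[symmetric] exp_add[symmetric] algebra_simps)
    ultimately show ?thesis by (simp add: f_def)
  qed
  show int: "integrable lborel (\<lambda>t. f (of_real t))"
  proof (rule Bochner_Integration.integrable_bound)
    have "integrable lborel (\<lambda>t::real. 1 / cosh t)"
      by (rule integral_even_function(1)[OF integrable_inverse_cosh]) simp
    from lborel_integrable_real_affine[OF this, of 1 "-u"]
    show "integrable lborel (\<lambda>t. 1 / cosh (t - u))" by simp
    have "norm (f (of_real t)) \<le> 1 / cosh (t - u)" for t
    proof -
      have "norm (f (of_real t)) = 1 / (cosh (t + u) * cosh (t - u))"
        unfolding f_def of_real_add[symmetric] of_real_diff[symmetric] cosh_complex_of_real
        by (simp add: norm_divide norm_mult)
      also have "\<dots> \<le> 1 / (1 * cosh (t - u))"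
        by (intro divide_left_mono mult_right_mono) (auto simp: cosh_real_ge_1)
      finally show ?thesis by simp
    qed
    thus "AE t in lborel. norm (f (of_real t)) \<le> norm (1 / cosh (t - u))"
      by (auto intro: order_trans)
    have "continuous_on UNIV (\<lambda>t. f (of_real t))"
      unfolding f_def of_real_add[symmetric] of_real_diff[symmetric] cosh_complex_of_real
      by (intro continuous_intros) auto
    thus "(\<lambda>t. f (of_real t)) \<in> borel_measurable lborel"
      by (simp add: borel_measurable_continuous_onI)
  qed
  have "(\<integral>t. f (of_real t) \<partial>lborel) - (\<integral>t. f (of_real t + \<i> * of_real pi) \<partial>lborel) = 2 * pi * \<i> * (\<Sum>p\<in>{p, q}. residue f p)"
  proof (rule strip_residue_theorem[where \<epsilon> = 1 and B = "\<lambda>R. 1 / (R - u)" and ?R0.0 = "u + 1"])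
    fix R s :: real assume R: "R \<ge> u + 1" and s: "0 \<le> s" "s \<le> pi"
    have "norm (f (Complex T s)) \<le> 1 / (R - u)" if T: "T = R \<or> T = - R" for T
    proof -
      have "\<bar>sinh (T + u)\<bar> * \<bar>sinh (T - u)\<bar> = sinh (R + u) * sinh (R - u)"
        using T R u sinh_minus[of "R - u"] sinh_minus[of "R + u"] by (auto simp: add.commute)
      also have "\<dots> \<ge> 1 * (R - u)"
        using R u sinh_real_ge_self[of "R + u"] sinh_real_ge_self[of "R - u"] by (intro mult_mono) auto
      finally have "R - u \<le> \<bar>sinh (T + u)\<bar> * \<bar>sinh (T - u)\<bar>" by simp
      also have "\<dots> \<le> norm (cosh (Complex (T + u) s)) * norm (cosh (Complex (T - u) s))"
        by (intro mult_mono abs_sinh_le_norm_cosh) auto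
      finally have le: "R - u \<le> norm (cosh (Complex (T + u) s)) * norm (cosh (Complex (T - u) s))" .
      have "Complex T s + of_real u = Complex (T + u) s" "Complex T s - of_real u = Complex (T - u) s"
        by (simp_all add: complex_eq_iff)
      hence "norm (f (Complex T s)) = exp (- (m * s)) / (norm (cosh (Complex (T + u) s)) * norm (cosh (Complex (T - u) s)))"
        by (simp add: f_def norm_divide norm_mult)
      also have "\<dots> \<le> 1 / (R - u)"
        using le R s m by (intro frac_le) auto
      finally show ?thesis .
    qed
    thus "norm (f (Complex R s)) \<le> 1 / (R - u) \<and> norm (f (Complex (- R) s)) \<le> 1 / (R - u)" by blast
  next
    show "((\<lambda>R. 1 / (R - u)) \<longlongrightarrow> 0) at_top" by real_asymp
    show "integrable lborel (\<lambda>t. f (of_real t + \<i> * of_real pi))"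
      unfolding per using int by simp
    show "f holomorphic_on {z. - 1 < Im z \<and> Im z < pi + 1} - {p, q}" using holo by (simp add: S_def)
    show "0 < Im z \<and> Im z < pi" if "z \<in> {p, q}" for z using that by (auto simp: p_def q_def)
  qed (use int in auto)
  also have "(\<Sum>p\<in>{p, q}. residue f p) = (exp (\<i> * of_real m * p) - exp (\<i> * of_real m * q)) / of_real (sinh (2 * u))"
    using pq(3) by (simp add: res_p res_q diff_divide_distrib)
  also have "2 * pi * \<i> * \<dots> = of_real (4 * pi * sin (m * u) * exp (- (pi * m / 2)) / sinh (2 * u))"
    unfolding e_pq by (simp add: field_simps)
  finally have eq: "(1 - of_real (exp (- (pi * m)))) * (\<integral>t. f (of_real t) \<partial>lborel) =
      of_real (4 * pi * sin (m * u) * exp (- (pi * m / 2)) / sinh (2 * u))"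
    unfolding per by (simp add: algebra_simps)
  \<comment> \<open>This is the factor of the unknown integral in the preceding identity; it is cancelled at the end.\<close>
  have e: "1 - exp (- (pi * m)) = 2 * sinh (pi * m / 2) * exp (- (pi * m / 2))"
    by (simp add: sinh_def algebra_simps flip: exp_add)
  have nz: "sinh (pi * m / 2) > 0" using m by simp
  have "complex_of_real (2 * sinh (pi * m / 2) * exp (- (pi * m / 2))) * (\<integral>t. f (of_real t) \<partial>lborel) =
      of_real (2 * sinh (pi * m / 2) * exp (- (pi * m / 2))) * of_real (2 * pi * sin (m * u) / (sinh (pi * m / 2) * sinh (2 * u)))"
    using eq nz m unfolding e[symmetric] of_real_mult[symmetric]
    by (subst e) (simp add: field_simps)
  moreover have "complex_of_real (2 * sinh (pi * m / 2) * exp (- (pi * m / 2))) \<noteq> 0"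
    using m by simp
  ultimately show "(\<integral>t. f (of_real t) \<partial>lborel) = of_real (2 * pi * sin (m * u) / (sinh (pi * m / 2) * sinh (2 * u)))"
    using mult_cancel_left by blast
qed

text \<open>The whole-line integral applies because \<open>cosh\<^sup>2 t + sinh\<^sup>2 u = cosh (t + u) cosh (t - u)\<close>.\<close>

lemma bessel_K_sine_transform:
  assumes m: "m > 0" and u: "u > 0"
  shows "(LBINT x:{0<..}. bessel_K m x * sin (x * sinh u)) = pi / 2 * sin (m * u) / (sinh (pi * m / 2) * cosh u)"
proof -
  define f where "f z = exp (\<i> * of_real m * z) / (cosh (z + of_real u) * cosh (z - of_real u))" for z
  define g where "g t = cos (m * t) * (sinh u / ((cosh t)\<^sup>2 + (sinh u)\<^sup>2))" for t
  note J = integral_exp_div_cosh_cosh[OF m u, folded f_def]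
  have g_eq: "g t = sinh u * Re (f (of_real t))" for t
  proof -
    have "cosh (t + u) * cosh (t - u) = (cosh t)\<^sup>2 * (cosh u)\<^sup>2 - (sinh t)\<^sup>2 * (sinh u)\<^sup>2"
      by (simp add: cosh_add cosh_diff power2_eq_square algebra_simps)
    also have "\<dots> = (cosh t)\<^sup>2 + (sinh u)\<^sup>2"
      by (simp add: cosh_square_eq algebra_simps)
    finally have "f (of_real t) = exp (\<i> * of_real m * of_real t) / of_real ((cosh t)\<^sup>2 + (sinh u)\<^sup>2)"
      unfolding f_def of_real_add[symmetric] of_real_diff[symmetric] cosh_complex_of_real of_real_mult[symmetric] by simp
    thus ?thesis by (simp add: g_def Re_exp Re_divide_of_real del: of_real_add of_real_power)
  qed
  have int: "integrable lborel g" unfolding g_eq[abs_def] using J(1) by simp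
  have "2 * (LBINT t:{0..}. g t) = (\<integral>t. g t \<partial>lborel)"
    using integral_even_function(2)[of g] integrable_mult_indicator[OF _ int, of "{0..}"]
    by (simp add: set_integrable_def g_def)
  also have "\<dots> = sinh u * Re (\<integral>t. f (of_real t) \<partial>lborel)"
    unfolding g_eq using J(1) by simp
  also have "\<dots> = sinh u * (2 * pi * sin (m * u) / (sinh (pi * m / 2) * (2 * sinh u * cosh u)))"
    unfolding J(2) by (simp add: sinh_double)
  also have "\<dots> = 2 * (pi / 2 * sin (m * u) / (sinh (pi * m / 2) * cosh u))"
    using u by simp
  finally show ?thesis
    unfolding bessel_K_sine_transform_eq by (simp add: g_def)
qed

section \<open>Biorthogonality\<close>

lemma integral_sin_times_sin:
  assumes "n \<ge> (1::nat)" "m \<ge> (1::nat)"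
  shows "(LBINT u:{0..pi}. sin (real n * u) * sin (real m * u)) = (if n = m then pi / 2 else 0)"
proof (cases "n = m")
  case True
  define q where "q = 2 * real n"
  have nz: "q \<noteq> 0" using assms by (simp add: q_def)
  have "(LBINT u:{0..pi}. sin (real n * u) * sin (real n * u)) =
     (pi - sin (q * pi) / q) / 2 - (0 - sin (q * 0) / q) / 2"
    unfolding set_lebesgue_integral_def
  proof (rule integral_FTC_atLeastAtMost)
    fix u :: real
    have *: "sin (real n * u) * sin (real n * u) = (1 - cos (q * u)) / 2"
      by (simp add: q_def sin_times_sin algebra_simps)
    have "((\<lambda>u. (u - sin (q * u) / q) / 2) has_real_derivative sin (real n * u) * sin (real n * u)) (at u within {0..pi})"
      unfolding * using nz by (auto intro!: derivative_eq_intros simp: field_simps)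
    thus "((\<lambda>u. (u - sin (q * u) / q) / 2) has_vector_derivative sin (real n * u) * sin (real n * u)) (at u within {0..pi})"
      by (simp add: has_real_derivative_iff_has_vector_derivative)
  qed (auto intro!: continuous_intros)
  also have "sin (q * pi) = 0" using sin_npi[of "2 * n"] by (simp add: q_def)
  finally show ?thesis using True by simp
next
  case False
  define p q where "p = real n - real m" and "q = real n + real m"
  have nz: "p \<noteq> 0" "q \<noteq> 0" using False assms by (auto simp: p_def q_def)
  have "(LBINT u:{0..pi}. sin (real n * u) * sin (real m * u)) =
     (sin (p * pi) / p - sin (q * pi) / q) / 2 - (sin (p * 0) / p - sin (q * 0) / q) / 2"
    unfolding set_lebesgue_integral_def
  proof (rule integral_FTC_atLeastAtMost)
    fix u :: real
    have *: "sin (real n * u) * sin (real m * u) = (cos (p * u) - cos (q * u)) / 2"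
      by (simp only: sin_times_sin p_def q_def left_diff_distrib distrib_right)
    have "((\<lambda>u. (sin (p * u) / p - sin (q * u) / q) / 2) has_real_derivative sin (real n * u) * sin (real m * u)) (at u within {0..pi})"
      unfolding * using nz by (auto intro!: derivative_eq_intros simp: field_simps)
    thus "((\<lambda>u. (sin (p * u) / p - sin (q * u) / q) / 2) has_vector_derivative sin (real n * u) * sin (real m * u)) (at u within {0..pi})"
      by (simp add: has_real_derivative_iff_has_vector_derivative)
  qed (auto intro!: continuous_intros)
  moreover have "sin (p * pi) = 0" "sin (q * pi) = 0"
    by (simp_all add: p_def q_def left_diff_distrib distrib_right sin_diff sin_add sin_npi)
  ultimately show ?thesis using False by simp
qed

text \<open>After integration by parts and Fubini, the sine transform of \<open>K\<close> cancels the weight \<open>cosh u\<close>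
  and leaves the orthogonality of the sines on \<open>[0, \<pi>]\<close>.\<close>

lemma trunc_K_bessel_K_biorthogonal:
  assumes n: "n \<ge> (1::nat)" and m: "m \<ge> (1::nat)"
  shows "(LBINT x:{0<..}. trunc_K n x * bessel_K m x / x) =
           (if n = m then pi\<^sup>2 / (2 * real n * sinh (pi * real n)) else 0)"
proof -
  define G where "G x = (LBINT u:{0..pi}. cosh u * sin (x * sinh u) * sin (real n * u))" for x
  define F where "F u x = (indicator {0..pi} u * (cosh u * sin (x * sinh u) * sin (real n * u))) *
      (indicator {0<..} x * bessel_K (real m) x)" for u x :: real
  have K0: "integrable lborel (\<lambda>x. indicator {0<..} x * bessel_K 0 x)"
    using set_integrable_bessel_K_0[of 1] by (simp add: set_integrable_def)
  have K0_nonneg: "bessel_K 0 x \<ge> 0" if "x > 0" for x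
    using abs_bessel_K_le[OF that, of 0] by simp
  have bound: "norm (F u x) \<le> (indicator {0..pi} u * cosh u) * (indicator {0<..} x * bessel_K 0 x)" for u x
  proof -
    have "\<bar>sin (x * sinh u)\<bar> * \<bar>sin (real n * u)\<bar> \<le> 1" by (intro mult_le_one) auto
    hence "\<bar>cosh u * sin (x * sinh u) * sin (real n * u)\<bar> \<le> cosh u"
      by (simp add: abs_mult mult.assoc mult_left_le)
    thus ?thesis unfolding F_def real_norm_def abs_mult[of "_ * _" "_ * _"]
      by (intro mult_mono) (auto simp: abs_bessel_K_le K0_nonneg indicator_def)
  qed
  have intF: "integrable lborel (F u)" for u
  proof (rule Bochner_Integration.integrable_bound[OF integrable_mult_right[OF K0, of "indicator {0..pi} u * cosh u"]])
    show "AE x in lborel. norm (F u x) \<le> norm ((indicator {0..pi} u * cosh u) * (indicator {0<..} x * bessel_K 0 x))"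
      using order_trans[OF bound abs_ge_self] by (intro AE_I2) simp
  qed (simp add: F_def[abs_def])
  have "integrable (lborel \<Otimes>\<^sub>M lborel) (\<lambda>(u, x). F u x)"
  proof (rule lborel_pair.Fubini_integrable)
    show "AE u in lborel. integrable lborel (\<lambda>x. (\<lambda>(u, x). F u x) (u, x))" using intF by simp
    show "integrable lborel (\<lambda>u. \<integral>x. norm ((\<lambda>(u, x). F u x) (u, x)) \<partial>lborel)"
    proof (rule Bochner_Integration.integrable_bound)
      have "set_integrable lborel {0..pi} (cosh :: real \<Rightarrow> real)"
        by (intro borel_integrable_atLeastAtMost' continuous_intros)
      thus "integrable lborel (\<lambda>u. (indicator {0..pi} u * cosh u) * (\<integral>x. indicator {0<..} x * bessel_K 0 x \<partial>lborel))"
        unfolding set_integrable_def by (intro integrable_mult_left) simp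
      have "(\<integral>x. norm (F u x) \<partial>lborel) \<le> (\<integral>x. (indicator {0..pi} u * cosh u) * (indicator {0<..} x * bessel_K 0 x) \<partial>lborel)" for u
        using intF K0 by (intro integral_mono bound integrable_norm integrable_mult_right)
      thus "AE u in lborel. norm (\<integral>x. norm ((\<lambda>(u, x). F u x) (u, x)) \<partial>lborel) \<le>
          norm ((indicator {0..pi} u * cosh u) * (\<integral>x. indicator {0<..} x * bessel_K 0 x \<partial>lborel))"
        by (auto intro!: order_trans[OF _ abs_ge_self])
    qed (auto simp: F_def)
  qed (auto simp: F_def)
  note Fubini = lborel_pair.Fubini_integral[OF this]
  have inner: "(\<integral>x. F u x \<partial>lborel) = pi / (2 * sinh (pi * m / 2)) * (indicator {0..pi} u * (sin (real n * u) * sin (real m * u)))" for u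
  \<comment> \<open>At \<open>u = 0\<close> the sine transform is not available, but both sides vanish there.\<close>
  proof (cases "u \<in> {0<..pi}")
    case True
    have "(\<integral>x. F u x \<partial>lborel) = (\<integral>x. (cosh u * sin (real n * u)) * (indicator {0<..} x * (bessel_K m x * sin (x * sinh u))) \<partial>lborel)"
      using True by (intro Bochner_Integration.integral_cong) (auto simp: F_def)
    also have "\<dots> = (cosh u * sin (real n * u)) * (LBINT x:{0<..}. bessel_K m x * sin (x * sinh u))"
      by (simp add: set_lebesgue_integral_def)
    also have "\<dots> = pi / (2 * sinh (pi * m / 2)) * (indicator {0..pi} u * (sin (real n * u) * sin (real m * u)))"
      using True m by (subst bessel_K_sine_transform) (auto simp: field_simps)
    finally show ?thesis .
  next
    case False
    hence "u = 0 \<or> u \<notin> {0..pi}" by auto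
    thus ?thesis by (auto simp: F_def)
  qed
  have "(\<integral>x. indicator {0<..} x * bessel_K m x * G x \<partial>lborel) = (\<integral>x. (\<integral>u. F u x \<partial>lborel) \<partial>lborel)"
    unfolding F_def G_def set_lebesgue_integral_def real_scaleR_def
    by (simp only: integral_mult_left_zero) (simp only: mult_ac)
  also have "\<dots> = (\<integral>u. pi / (2 * sinh (pi * m / 2)) * (indicator {0..pi} u * (sin (real n * u) * sin (real m * u))) \<partial>lborel)"
    unfolding Fubini by (simp only: inner)
  also have "\<dots> =
      pi / (2 * sinh (pi * m / 2)) * (if n = m then pi / 2 else 0)"
    using integral_sin_times_sin[OF n m] by (simp add: set_lebesgue_integral_def)
  finally have key: "(\<integral>x. indicator {0<..} x * bessel_K m x * G x \<partial>lborel) = pi / (2 * sinh (pi * m / 2)) * (if n = m then pi / 2 else 0)" .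
  have trunc_eq: "trunc_K n x = x / (n * cosh (pi * n / 2)) * G x" for x
    unfolding G_def by (rule trunc_K_by_parts[OF n])
  have "(LBINT x:{0<..}. trunc_K n x * bessel_K m x / x) = (\<integral>x. 1 / (n * cosh (pi * n / 2)) * (indicator {0<..} x * bessel_K m x * G x) \<partial>lborel)"
    unfolding set_lebesgue_integral_def trunc_eq
    by (intro Bochner_Integration.integral_cong) (auto simp: indicator_def)
  also have "\<dots> = 1 / (n * cosh (pi * n / 2)) * (pi / (2 * sinh (pi * m / 2)) * (if n = m then pi / 2 else 0))"
    by (simp only: integral_mult_right_zero key)
  also have "\<dots> = (if n = m then pi\<^sup>2 / (2 * real n * sinh (pi * real n)) else 0)"
    using sinh_double[of "pi * real n / 2"] by (auto simp: power2_eq_square field_simps)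
  finally show ?thesis .
qed

section \<open>Termwise integration and the expansions\<close>

text \<open>Termwise integration under a bound that separates the index from the variable.\<close>

lemma iterated_series_integral:
  fixes g :: "real \<Rightarrow> complex" and f :: "nat \<Rightarrow> real \<Rightarrow> complex" and c :: "nat \<Rightarrow> real" and p h :: "real \<Rightarrow> real"
  assumes [measurable]: "g \<in> borel_measurable borel" "\<And>m. f m \<in> borel_measurable borel"
    and c: "summable c" "\<And>k. c k \<ge> 0"
    and f: "\<And>k x. x > 0 \<Longrightarrow> norm (f (Suc k) x) \<le> c k * p x"
    and h: "set_integrable lborel {0<..} h" "\<And>x. x > 0 \<Longrightarrow> norm (g x) * p x / x \<le> h x"
  shows "iterated_abs_convergent g f"
    and "iterated_integral g f = (\<Sum>k. LBINT x:{0<..}. g x * f (Suc k) x / of_real x)"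
proof -
  define F where "F k x = indicator {0<..} x *\<^sub>R (g x * f (Suc k) x / of_real x)" for k x
  have [measurable]: "F k \<in> borel_measurable lborel" for k
    unfolding F_def[abs_def] by measurable
  have sf: "summable (\<lambda>k. norm (f (Suc k) x))" if "x > 0" for x
    by (rule summable_comparison_test'[OF summable_mult2[OF c(1), of "p x"]]) (use f[OF that] in auto)
  have sF: "summable (\<lambda>k. norm (F k x))" for x
  proof (cases "x > 0")
    case True
    have "summable (\<lambda>k. norm (g x) / x * norm (f (Suc k) x))" by (intro summable_mult sf True)
    also have "(\<lambda>k. norm (g x) / x * norm (f (Suc k) x)) = (\<lambda>k. norm (F k x))"
      using True by (simp add: F_def norm_mult norm_divide)
    finally show ?thesis .
  qed (simp add: F_def)
  have H: "integrable lborel (\<lambda>x. indicator {0<..} x * h x)" using h(1) by (simp add: set_integrable_def)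
  have bF: "norm (F k x) \<le> c k * (indicator {0<..} x * h x)" for k x
  proof (cases "x > 0")
    case True
    have "norm (F k x) = norm (g x) * norm (f (Suc k) x) / x"
      using True by (simp add: F_def norm_mult norm_divide)
    also have "\<dots> \<le> norm (g x) * (c k * p x) / x"
      using True f[OF True] by (intro divide_right_mono mult_left_mono) auto
    also have "\<dots> = c k * (norm (g x) * p x / x)" by simp
    also have "\<dots> \<le> c k * h x" by (intro mult_left_mono h(2) True c(2))
    finally show ?thesis using True by simp
  qed (simp add: F_def)
  have iF: "integrable lborel (F k)" for k
    by (rule Bochner_Integration.integrable_bound[OF integrable_mult_right[OF H, of "c k"]])
       (use order_trans[OF bF abs_ge_self] in auto)
  have sI: "summable (\<lambda>k. \<integral>x. norm (F k x) \<partial>lborel)"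
  proof (rule summable_comparison_test')
    show "summable (\<lambda>k. c k * (\<integral>x. indicator {0<..} x * h x \<partial>lborel))"
      by (intro summable_mult2 c(1))
    fix k
    have "(\<integral>x. norm (F k x) \<partial>lborel) \<le> (\<integral>x. c k * (indicator {0<..} x * h x) \<partial>lborel)"
      by (intro integral_mono bF integrable_norm iF integrable_mult_right H)
    thus "norm (\<integral>x. norm (F k x) \<partial>lborel) \<le> c k * (\<integral>x. indicator {0<..} x * h x \<partial>lborel)"
      by simp
  qed
  have sumF: "(\<Sum>k. F k x) = indicator {0<..} x *\<^sub>R (g x * (\<Sum>k. f (Suc k) x) / of_real x)" for x
  proof (cases "x > 0")
    case True
    have "summable (\<lambda>k. f (Suc k) x)" by (rule summable_norm_cancel[OF sf[OF True]])
    hence "(\<Sum>k. g x / of_real x * f (Suc k) x) = g x / of_real x * (\<Sum>k. f (Suc k) x)"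
      by (rule suminf_mult)
    thus ?thesis using True by (simp add: F_def)
  qed (simp add: F_def)
  have sumNF: "(\<Sum>k. norm (F k x)) = indicator {0<..} x *\<^sub>R (norm (g x) * (\<Sum>k. norm (f (Suc k) x)) / x)" for x
  proof (cases "x > 0")
    case True
    have "(\<Sum>k. norm (g x) / x * norm (f (Suc k) x)) = norm (g x) / x * (\<Sum>k. norm (f (Suc k) x))"
      by (rule suminf_mult[OF sf[OF True]])
    thus ?thesis using True by (simp add: F_def norm_mult norm_divide)
  qed (simp add: F_def)
  have "integrable lborel (\<lambda>x. \<Sum>k. F k x)"
    by (rule integrable_suminf[OF iF _ sI]) (use sF in auto)
  moreover have "integrable lborel (\<lambda>x. \<Sum>k. norm (F k x))"
    by (rule integrable_suminf) (use sF sI iF in auto)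
  ultimately show "iterated_abs_convergent g f"
    unfolding iterated_abs_convergent_def set_integrable_def sumF sumNF using sf by blast
  have "iterated_integral g f = (\<integral>x. (\<Sum>k. F k x) \<partial>lborel)"
    by (simp add: iterated_integral_def set_lebesgue_integral_def sumF)
  also have "\<dots> = (\<Sum>k. \<integral>x. F k x \<partial>lborel)"
    by (rule integral_suminf[OF iF _ sI]) (use sF in auto)
  finally show "iterated_integral g f = (\<Sum>k. LBINT x:{0<..}. g x * f (Suc k) x / of_real x)"
    by (simp add: F_def set_lebesgue_integral_def)
qed

text \<open>Here \<open>r m\<close> stands for the product of the two real kernels with the weight \<open>1/x\<close>, so that both
  expansions are covered. Only the summand with \<open>Suc k = n\<close> survives.\<close>

lemma coefficient_from_biorthogonality:
  assumes n: "n \<ge> (1::nat)"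
    and I: "iterated_integral g f = (\<Sum>k. LBINT x:{0<..}. g x * f (Suc k) x / of_real x)"
    and gf: "\<And>m x. m \<ge> 1 \<Longrightarrow> g x * f m x / of_real x = a m * of_real (r m x)"
    and r: "\<And>m. m \<ge> 1 \<Longrightarrow> (LBINT x:{0<..}. r m x) = (if m = n then pi\<^sup>2 / (2 * real n * sinh (pi * real n)) else 0)"
  shows "a n = complex_of_real (2 / pi^2 * real n * sinh (pi * real n)) * iterated_integral g f"
proof -
  define v where "v = pi\<^sup>2 / (2 * real n * sinh (pi * real n))"
  have "(LBINT x:{0<..}. g x * f (Suc k) x / of_real x) = (if k = n - 1 then a (Suc k) * of_real v else 0)" for k
  proof -
    have "(LBINT x:{0<..}. g x * f (Suc k) x / of_real x) = a (Suc k) * of_real (LBINT x:{0<..}. r (Suc k) x)"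
      by (simp add: gf set_integral_complex_of_real)
    thus ?thesis using n by (auto simp: r v_def)
  qed
  hence "iterated_integral g f = (\<Sum>k. if k = n - 1 then a (Suc k) * of_real v else 0)"
    unfolding I by simp
  also have "\<dots> = a n * of_real v"
    using sums_unique[OF sums_single[of "n - 1" "\<lambda>k. a (Suc k) * of_real v"]] n by simp
  finally have "complex_of_real (2 / pi^2 * real n * sinh (pi * real n)) * iterated_integral g f =
     a n * of_real (2 / pi^2 * real n * sinh (pi * real n) * v)" by simp
  also have "2 / pi^2 * real n * sinh (pi * real n) * v = 1"
    using n by (simp add: v_def)
  finally show ?thesis by simp
qed

lemma expansion_in_bessel_K:
  fixes a :: "nat \<Rightarrow> complex"
  assumes d: "0 \<le> \<delta>" "\<delta> < pi / 2" and s: "summable (\<lambda>k. norm (a (Suc k)) * exp (- \<delta> * real (Suc k)))"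
    and n: "n \<ge> 1"
  defines "g \<equiv> \<lambda>x. complex_of_real (trunc_K (real n) x)" and "f \<equiv> \<lambda>m x. a m * complex_of_real (bessel_K (real m) x)"
  shows "iterated_abs_convergent g f"
    and "a n = complex_of_real (2 / pi^2 * real n * sinh (pi * real n)) * iterated_integral g f"
proof -
  define C where "C = 2 * sinh pi * (exp (- pi * n / 2) / n)"
  have cosd: "cos \<delta> > 0" using d by (intro cos_gt_zero_pi) auto
  have meas: "g \<in> borel_measurable borel" "f m \<in> borel_measurable borel" for m
    by (simp_all add: g_def f_def)
  have b1: "norm (f (Suc k) x) \<le> norm (a (Suc k)) * exp (- \<delta> * real (Suc k)) * bessel_K 0 (cos \<delta> * x)" if "x > 0" for k x
    using mult_left_mono[OF abs_bessel_K_le_exp[of "real (Suc k)" \<delta> x], of "norm (a (Suc k))"] d that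
    by (simp add: f_def norm_mult mult.assoc)
  have b2: "norm (g x) * bessel_K 0 (cos \<delta> * x) / x \<le> C * bessel_K 0 (cos \<delta> * x)" if x: "x > 0" for x
  proof -
    have "bessel_K 0 (cos \<delta> * x) \<ge> 0" using abs_bessel_K_le[of "cos \<delta> * x" 0] x cosd by simp
    moreover have "norm (g x) \<le> C * x" using abs_trunc_K_le[OF n x] by (simp add: g_def C_def)
    ultimately have "norm (g x) * bessel_K 0 (cos \<delta> * x) \<le> C * x * bessel_K 0 (cos \<delta> * x)"
      by (intro mult_right_mono)
    thus ?thesis using x by (simp add: field_simps)
  qed
  note * = iterated_series_integral[OF meas s _ b1 set_integrable_mult_right[OF set_integrable_bessel_K_0[OF cosd]] b2]
  show "iterated_abs_convergent g f" by (rule *(1)) auto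
  show "a n = complex_of_real (2 / pi^2 * real n * sinh (pi * real n)) * iterated_integral g f"
  proof (rule coefficient_from_biorthogonality[OF n *(2)])
    fix m :: nat and x :: real assume m: "m \<ge> 1"
    show "g x * f m x / of_real x = a m * of_real (trunc_K n x * bessel_K m x / x)"
      by (simp add: g_def f_def)
    show "(LBINT x:{0<..}. trunc_K n x * bessel_K m x / x) = (if m = n then pi\<^sup>2 / (2 * real n * sinh (pi * real n)) else 0)"
      using trunc_K_bessel_K_biorthogonal[OF n m] by auto
  qed auto
qed

lemma expansion_in_trunc_K:
  fixes a :: "nat \<Rightarrow> complex"
  assumes s: "summable (\<lambda>k. norm (a (Suc k)) / real (Suc k) * exp (- pi * real (Suc k) / 2))"
    and n: "n \<ge> 1"
  defines "g \<equiv> \<lambda>x. complex_of_real (bessel_K (real n) x)" and "f \<equiv> \<lambda>m x. a m * complex_of_real (trunc_K (real m) x)"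
  shows "iterated_abs_convergent g f"
    and "a n = complex_of_real (2 / pi^2 * real n * sinh (pi * real n)) * iterated_integral g f"
proof -
  have meas: "g \<in> borel_measurable borel" "f m \<in> borel_measurable borel" for m
    by (simp_all add: g_def f_def)
  have b1: "norm (f (Suc k) x) \<le> 2 * sinh pi * (norm (a (Suc k)) / real (Suc k) * exp (- pi * real (Suc k) / 2)) * x" if "x > 0" for k x
    using mult_left_mono[OF abs_trunc_K_le[of "Suc k" x], of "norm (a (Suc k))"] that
    by (simp add: f_def norm_mult mult_ac)
  have b2: "norm (g x) * x / x \<le> bessel_K 0 (1 * x)" if "x > 0" for x
    using abs_bessel_K_le[OF that, of n] that by (simp add: g_def)
  note * = iterated_series_integral[OF meas summable_mult[OF s] _ b1 set_integrable_bessel_K_0[of 1] b2]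
  show "iterated_abs_convergent g f" by (rule *(1)) auto
  show "a n = complex_of_real (2 / pi^2 * real n * sinh (pi * real n)) * iterated_integral g f"
  proof (rule coefficient_from_biorthogonality[OF n *(2)])
    fix m :: nat and x :: real assume m: "m \<ge> 1"
    show "g x * f m x / of_real x = a m * of_real (trunc_K m x * bessel_K n x / x)"
      by (simp add: g_def f_def)
    show "(LBINT x:{0<..}. trunc_K m x * bessel_K n x / x) = (if m = n then pi\<^sup>2 / (2 * real n * sinh (pi * real n)) else 0)"
      using trunc_K_bessel_K_biorthogonal[OF m n] by auto
  qed auto
qed

lemma summable_weaken_weight:
  assumes d: "0 \<le> \<delta>" "\<delta> < pi / 2" and s: "summable (\<lambda>k. norm (a (Suc k)) * exp (- \<delta> * real (Suc k)))"
  shows "summable (\<lambda>k. norm (a (Suc k)) / real (Suc k) * exp (- pi * real (Suc k) / 2))"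
proof (rule summable_comparison_test'[OF s])
  fix k :: nat
  have "norm (a (Suc k)) / real (Suc k) \<le> norm (a (Suc k)) / 1"
    by (intro divide_left_mono) auto
  moreover have "exp (- pi * real (Suc k) / 2) \<le> exp (- \<delta> * real (Suc k))"
    using mult_right_mono[of \<delta> "pi / 2" "real (Suc k)"] d by simp
  ultimately have "norm (a (Suc k)) / real (Suc k) * exp (- pi * real (Suc k) / 2) \<le> norm (a (Suc k)) / 1 * exp (- \<delta> * real (Suc k))"
    by (intro mult_mono) auto
  thus "norm (norm (a (Suc k)) / real (Suc k) * exp (- pi * real (Suc k) / 2)) \<le> norm (a (Suc k)) * exp (- \<delta> * real (Suc k))"
    by simp
qed

theorem theorem3:
  fixes a :: "nat \<Rightarrow> complex"
  shows
    "((\<exists>\<delta>\<in>{0..<pi/2}. summable (\<lambda>k. norm (a (Suc k)) * exp (- \<delta> * real (Suc k)))) \<longrightarrow>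
       (\<forall>n\<ge>1.
          iterated_abs_convergent
            (\<lambda>x. K_c x (\<i> * of_nat n) pi) (\<lambda>m x. a m * macdonald_K (\<i> * of_nat m) x) \<and>
          a n = complex_of_real (2 / pi^2 * real n * sinh (pi * real n)) *
            iterated_integral
              (\<lambda>x. K_c x (\<i> * of_nat n) pi) (\<lambda>m x. a m * macdonald_K (\<i> * of_nat m) x) \<and>
          iterated_abs_convergent
            (\<lambda>x. macdonald_K (\<i> * of_nat n) x) (\<lambda>m x. a m * K_c x (\<i> * of_nat m) pi) \<and>
          a n = complex_of_real (2 / pi^2 * real n * sinh (pi * real n)) *
            iterated_integral
              (\<lambda>x. macdonald_K (\<i> * of_nat n) x) (\<lambda>m x. a m * K_c x (\<i> * of_nat m) pi)))
     \<and>
     (summable (\<lambda>k. norm (a (Suc k)) / real (Suc k) * exp (- pi * real (Suc k) / 2)) \<longrightarrow>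
       (\<forall>n\<ge>1.
          iterated_abs_convergent
            (\<lambda>x. macdonald_K (\<i> * of_nat n) x) (\<lambda>m x. a m * K_c x (\<i> * of_nat m) pi) \<and>
          a n = complex_of_real (2 / pi^2 * real n * sinh (pi * real n)) *
            iterated_integral
              (\<lambda>x. macdonald_K (\<i> * of_nat n) x) (\<lambda>m x. a m * K_c x (\<i> * of_nat m) pi)))"
  unfolding macdonald_K_eq_bessel_K K_c_eq_trunc_K
proof (intro conjI impI allI)
  fix n :: nat
  assume "\<exists>\<delta>\<in>{0..<pi/2}. summable (\<lambda>k. norm (a (Suc k)) * exp (- \<delta> * real (Suc k)))" and n: "n \<ge> 1"
  then obtain \<delta> where d: "0 \<le> \<delta>" "\<delta> < pi / 2"
    and s: "summable (\<lambda>k. norm (a (Suc k)) * exp (- \<delta> * real (Suc k)))" by auto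
  note 1 = expansion_in_bessel_K[OF d s n] expansion_in_trunc_K[OF summable_weaken_weight[OF d s] n]
  show "iterated_abs_convergent (\<lambda>x. of_real (trunc_K (real n) x)) (\<lambda>m x. a m * of_real (bessel_K (real m) x))"
    by (rule 1)
  show "a n = complex_of_real (2 / pi^2 * real n * sinh (pi * real n)) *
     iterated_integral (\<lambda>x. of_real (trunc_K (real n) x)) (\<lambda>m x. a m * of_real (bessel_K (real m) x))"
    by (rule 1)
  show "iterated_abs_convergent (\<lambda>x. of_real (bessel_K (real n) x)) (\<lambda>m x. a m * of_real (trunc_K (real m) x))"
    by (rule 1)
  show "a n = complex_of_real (2 / pi^2 * real n * sinh (pi * real n)) *
     iterated_integral (\<lambda>x. of_real (bessel_K (real n) x)) (\<lambda>m x. a m * of_real (trunc_K (real m) x))"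
    by (rule 1)
next
  fix n :: nat
  assume s: "summable (\<lambda>k. norm (a (Suc k)) / real (Suc k) * exp (- pi * real (Suc k) / 2))" and n: "n \<ge> 1"
  show "iterated_abs_convergent (\<lambda>x. of_real (bessel_K (real n) x)) (\<lambda>m x. a m * of_real (trunc_K (real m) x))"
    by (rule expansion_in_trunc_K[OF s n])
  show "a n = complex_of_real (2 / pi^2 * real n * sinh (pi * real n)) *
     iterated_integral (\<lambda>x. of_real (bessel_K (real n) x)) (\<lambda>m x. a m * of_real (trunc_K (real m) x))"
    by (rule expansion_in_trunc_K[OF s n])
qed

end
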